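(* Let $F_m$ be the free group on $x_1,\dots,x_m$, let $\{a_1,\dots,a_k\}$ generate the semigroup $\mathcal A\subset \mathrm{Aut}(F_m)$, and let $A_1,\dots,A_k$ be the incidence matrices of $a_1,\dots,a_k$. Then the entropy efficiency of $\mathcal A$ is bounded above by the logarithm of the generalized spectral radius of the collection of incidence matrices: $$\mathrm{Eff}(\mathcal A;\{a_1,\dots,a_k\})\le \log \rho(\{A_1,\dots,A_k\}).$$
   Context: For $g\in F_m$, $n_i(g)$ is the number of occurrences of $x_i$ or $x_i^{-1}$ in the reduced form of $g$, and $\ell(g)$ is its reduced word length. The incidence matrix of $a\in\mathrm{Aut}(F_m)$ is the $m\times m$ matrix $A$ with $A_{ij}=n_j(a(x_i))$. The entropy of $a$ is $h(a)=\max_i\limsup_{n\to\infty}\frac1n\log\ell(a^n(x_i))$. For $a\in\mathcal A$ let $L(a)$ be the minimal length $r\ge1$ of a word $a_{i_1}\cdots a_{i_r}$ in the generators equal to $a$; $\mathrm{eff}(a)=h(a)/L(a)$; and $\mathrm{Eff}(\mathcal A;\{a_1,\dots,a_k\})=\sup\{\mathrm{eff}(a):a\in\mathcal A\}$. For a finite set $\mathcal M=\{M_1,\dots,M_k\}$ of square matrices of the same size and $r\ge1$, put $\rho_r(\mathcal M)=\max\{\rho(M_{i_1}\cdots M_{i_r})^{1/r}: M_{i_j}\in\mathcal M\}$, where $\rho$ of a single matrix is its spectral radius; the generalized spectral radius is $\rho(\mathcal M)=\limsup_{r\to\infty}\rho_r(\mathcal M)$. *)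

theory Defs
  imports
    "HOL-Algebra.Bij"
    "HOL-Library.Extended_Real"
    "HOL-Library.Liminf_Limsup"
    "Jordan_Normal_Form.Spectral_Radius"
begin

section \<open>The free group of rank \<open>m\<close>\<close>

text \<open>
  The letter \<open>(i, True)\<close> stands for the generator \<open>x\<^sub>i\<close> and \<open>(i, False)\<close> for its inverse;
  the generators are numbered \<open>0, \<dots>, m - 1\<close>. An element of the free group is its reduced form.
\<close>

type_synonym letter = "nat \<times> bool"

definition inv_letter :: "letter \<Rightarrow> letter" where
  "inv_letter x = (fst x, \<not> snd x)"

definition reduced :: "letter list \<Rightarrow> bool" where
  "reduced w \<longleftrightarrow> successively (\<lambda>x y. y \<noteq> inv_letter x) w"

fun push :: "letter \<Rightarrow> letter list \<Rightarrow> letter list" where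
  "push x [] = [x]"
| "push x (y # w) = (if y = inv_letter x then w else x # y # w)"

definition reduce :: "letter list \<Rightarrow> letter list" where
  "reduce w = foldr push w []"

definition free_group :: "nat \<Rightarrow> letter list monoid" where
  "free_group m =
    \<lparr>carrier = {w. fst ` set w \<subseteq> {..<m} \<and> reduced w},
     monoid.mult = (\<lambda>u v. reduce (u @ v)),
     one = []\<rparr>"

definition free_gen :: "nat \<Rightarrow> letter list" where
  "free_gen i = [(i, True)]"

lemma inv_letter_inv_letter [simp]: "inv_letter (inv_letter x) = x"
  by (simp add: inv_letter_def)

lemma inv_letter_neq [simp]: "inv_letter x \<noteq> x" "x \<noteq> inv_letter x"
  by (auto simp: inv_letter_def prod_eq_iff)

lemma fst_inv_letter [simp]: "fst (inv_letter x) = fst x"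
  by (simp add: inv_letter_def)

lemma reduced_Nil [simp]: "reduced []"
  by (simp add: reduced_def)

lemma reduced_Cons: "reduced (x # w) \<longleftrightarrow> (w = [] \<or> hd w \<noteq> inv_letter x) \<and> reduced w"
  by (cases w) (auto simp: reduced_def)

lemma reduced_push: "reduced w \<Longrightarrow> reduced (push x w)"
  by (cases w) (auto simp: reduced_Cons)

lemma reduced_foldr_push: "reduced v \<Longrightarrow> reduced (foldr push u v)"
  by (induction u) (auto intro: reduced_push)

lemma reduced_reduce: "reduced (reduce w)"
  by (simp add: reduce_def reduced_foldr_push)

lemma reduce_reduced: "reduced w \<Longrightarrow> reduce w = w"
proof (induction w)
  case (Cons x w)
  then show ?case by (cases w) (auto simp: reduce_def reduced_Cons)
qed (simp add: reduce_def)

lemma push_inv_push: "reduced w \<Longrightarrow> push x (push (inv_letter x) w) = w"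
proof (cases w)
  case (Cons y v)
  assume "reduced w"
  with Cons show ?thesis by (cases v) (auto simp: reduced_Cons)
qed simp

lemma foldr_push_push: "reduced v \<Longrightarrow> foldr push (push x u) v = push x (foldr push u v)"
proof (cases u)
  case (Cons y u')
  assume "reduced v"
  with Cons show ?thesis
    using push_inv_push[OF reduced_foldr_push[of v u'], of x] by auto
qed simp

lemma foldr_push_reduce: "reduced v \<Longrightarrow> foldr push (reduce u) v = foldr push u v"
  by (induction u) (auto simp: reduce_def foldr_push_push)

lemma set_push: "set (push x w) \<subseteq> insert x (set w)"
  by (cases w) auto

lemma set_reduce: "set (reduce w) \<subseteq> set w"
proof (induction w)
  case (Cons x w)
  then show ?case using set_push[of x "reduce w"] by (auto simp: reduce_def)
qed (simp add: reduce_def)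

lemma reduce_append: "reduce (u @ v) = foldr push u (reduce v)"
  by (simp add: reduce_def)

lemma reduce_inverse: "reduced w \<Longrightarrow> foldr push (rev (map inv_letter w)) w = []"
proof (induction w)
  case (Cons x w)
  then show ?case by (simp add: reduced_Cons)
qed simp

lemma group_free_group: "group (free_group m)"
proof (rule groupI)
  fix u v assume "u \<in> carrier (free_group m)" "v \<in> carrier (free_group m)"
  then show "u \<otimes>\<^bsub>free_group m\<^esub> v \<in> carrier (free_group m)"
    using set_reduce[of "u @ v"] by (fastforce simp: free_group_def reduced_reduce)
next
  fix u v w
  assume "w \<in> carrier (free_group m)"
  then show "u \<otimes>\<^bsub>free_group m\<^esub> v \<otimes>\<^bsub>free_group m\<^esub> w =
      u \<otimes>\<^bsub>free_group m\<^esub> (v \<otimes>\<^bsub>free_group m\<^esub> w)"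
    by (simp add: free_group_def reduce_append foldr_push_reduce reduced_foldr_push
        reduced_reduce reduce_reduced del: foldr_append)
       (simp add: reduce_def[symmetric] foldr_push_reduce reduced_foldr_push reduce_reduced
        flip: reduce_append)
next
  fix u assume u: "u \<in> carrier (free_group m)"
  let ?v = "reduce (rev (map inv_letter u))"
  have "?v \<in> carrier (free_group m)"
    using u set_reduce[of "rev (map inv_letter u)"]
    by (fastforce simp: free_group_def reduced_reduce)
  moreover have "?v \<otimes>\<^bsub>free_group m\<^esub> u = \<one>\<^bsub>free_group m\<^esub>"
    using u by (simp add: free_group_def reduce_append reduce_reduced foldr_push_reduce
        reduce_inverse)
  ultimately show "\<exists>v\<in>carrier (free_group m). v \<otimes>\<^bsub>free_group m\<^esub> u = \<one>\<^bsub>free_group m\<^esub>"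
    by blast
qed (auto simp: free_group_def reduce_reduced)


section \<open>Incidence matrices and entropy\<close>

definition occurrences :: "nat \<Rightarrow> letter list \<Rightarrow> nat" where
  "occurrences j g = length (filter (\<lambda>x. fst x = j) g)"

text \<open>The entries are natural numbers; they are taken in the complex numbers because
  \<open>spectral_radius\<close> is defined for complex matrices.\<close>

definition incidence_matrix :: "nat \<Rightarrow> (letter list \<Rightarrow> letter list) \<Rightarrow> complex mat" where
  "incidence_matrix m a = mat m m (\<lambda>(i, j). of_nat (occurrences j (a (free_gen i))))"

definition entropy :: "nat \<Rightarrow> (letter list \<Rightarrow> letter list) \<Rightarrow> ereal" where
  "entropy m a =
    Max ((\<lambda>i. limsup (\<lambda>n. ereal (ln (real (length ((a ^^ n) (free_gen i)))) / real n))) ` {..<m})"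


section \<open>Generated semigroups and efficiency\<close>

inductive_set semigroup_generated :: "('a, 'b) monoid_scheme \<Rightarrow> 'a set \<Rightarrow> 'a set"
  for G :: "('a, 'b) monoid_scheme" and S :: "'a set" where
  generator: "a \<in> S \<Longrightarrow> a \<in> semigroup_generated G S"
| product: "a \<in> semigroup_generated G S \<Longrightarrow> b \<in> semigroup_generated G S \<Longrightarrow>
    a \<otimes>\<^bsub>G\<^esub> b \<in> semigroup_generated G S"

definition semigroup_length :: "('a, 'b) monoid_scheme \<Rightarrow> 'a set \<Rightarrow> 'a \<Rightarrow> nat" where
  "semigroup_length G S a =
    (LEAST r. 1 \<le> r \<and> (\<exists>w. length w = r \<and> set w \<subseteq> S \<and> foldr (\<otimes>\<^bsub>G\<^esub>) w \<one>\<^bsub>G\<^esub> = a))"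

definition efficiency ::
    "nat \<Rightarrow> (letter list \<Rightarrow> letter list) set \<Rightarrow> (letter list \<Rightarrow> letter list) \<Rightarrow> ereal" where
  "efficiency m S a =
    entropy m a / ereal (real (semigroup_length (AutoGroup (free_group m)) S a))"

definition Efficiency ::
    "nat \<Rightarrow> (letter list \<Rightarrow> letter list) set \<Rightarrow> (letter list \<Rightarrow> letter list) set \<Rightarrow> ereal" where
  "Efficiency m \<A> S = (SUP a\<in>\<A>. efficiency m S a)"


section \<open>The generalized spectral radius\<close>

text \<open>The argument \<open>n\<close> is the common size of the matrices in \<open>\<M>\<close>.\<close>

definition max_spectral_radius :: "nat \<Rightarrow> nat \<Rightarrow> complex mat set \<Rightarrow> real" where
  "max_spectral_radius n r \<M> =
    Max {root r (spectral_radius (foldr (*) Ms (1\<^sub>m n))) | Ms. length Ms = r \<and> set Ms \<subseteq> \<M>}"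

definition generalized_spectral_radius :: "nat \<Rightarrow> complex mat set \<Rightarrow> ereal" where
  "generalized_spectral_radius n \<M> = limsup (\<lambda>r. ereal (max_spectral_radius n r \<M>))"

definition ereal_ln :: "ereal \<Rightarrow> ereal" where
  "ereal_ln x = (if x \<le> 0 then - \<infinity> else if x = \<infinity> then \<infinity> else ereal (ln (real_of_ereal x)))"

end

theory Submission
  imports Defs
begin

text \<open>
  Let \<open>b = a\<^sub>1 \<cdots> a\<^sub>r\<close> be an element of the semigroup written with the least number
  \<open>r\<close> of generators. Cancellation can only remove letters, so the number of letters
  \<open>x\<^sub>j\<^sup>\<plusminus>\<close> in \<open>f (g x\<^sub>i)\<close> is at most the \<open>(i, j)\<close> entry of the incidence matrix of \<open>g\<close> times
  that of \<open>f\<close> (\<open>dominates_comp\<close>). Note the order: since row \<open>i\<close> of an incidence matrix describes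
  the image of \<open>x\<^sub>i\<close>, composition becomes multiplication in reverse order. The matrix
  \<open>M = A\<^sub>r \<cdots> A\<^sub>1\<close> therefore bounds \<open>b\<close>, and \<open>M\<^sup>n\<close> bounds \<open>b\<^sup>n\<close>.

  The entries of \<open>M\<^sup>n\<close> grow at most like \<open>t\<^sup>n\<close> for every \<open>t\<close> above the spectral radius
  \<open>\<rho>\<close> of \<open>M\<close> (\<open>power_entries_le\<close>), so the entropy of \<open>b\<close> is at most \<open>ln \<rho>\<close>
  (\<open>entropy_le_ln_spectral_radius\<close>). Because \<open>b\<close> is injective, the words \<open>b\<^sup>n x\<^sub>i\<close> never
  become empty, which forces \<open>\<rho> \<ge> 1\<close> and keeps the logarithms meaningful.

  On the other side, \<open>M\<^sup>n\<close> is a product of \<open>r n\<close> incidence matrices, and its spectral radius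
  is at least \<open>\<rho>\<^sup>n\<close>; taking \<open>r n\<close>-th roots, the \<open>r\<close>-th root of \<open>\<rho>\<close> bounds the generalized
  spectral radius from below (\<open>generalized_spectral_radius_ge\<close>). Together,
  \<open>h(b) / r \<le> (ln \<rho>) / r\<close> is at most the logarithm of the generalized spectral radius.
\<close>

section \<open>Occurrence counts in reduced words\<close>

lemma occurrences_Nil [simp]: "occurrences j [] = 0"
  by (simp add: occurrences_def)

lemma occurrences_append [simp]: "occurrences j (u @ v) = occurrences j u + occurrences j v"
  by (simp add: occurrences_def)

lemma occurrences_Cons: "occurrences j (x # w) = (if fst x = j then 1 else 0) + occurrences j w"
  by (simp add: occurrences_def)

lemma occurrences_push_le: "occurrences j (push x w) \<le> occurrences j (x # w)"
  by (cases w) (auto simp: occurrences_Cons)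

lemma occurrences_reduce_le: "occurrences j (reduce w) \<le> occurrences j w"
proof (induction w)
  case (Cons x w)
  then show ?case
    using occurrences_push_le[of j x "reduce w"] by (auto simp: reduce_def occurrences_Cons)
qed (simp add: reduce_def)

lemma occurrences_rev_map_inv_letter: "occurrences j (rev (map inv_letter w)) = occurrences j w"
  by (induction w) (auto simp: occurrences_Cons)

lemma length_eq_sum_occurrences:
  assumes "fst ` set w \<subseteq> {..<m}"
  shows "length w = (\<Sum>j<m. occurrences j w)"
  using assms by (induction w) (auto simp: occurrences_Cons sum.distrib)

lemma occurrences_mult_le:
  "occurrences j (u \<otimes>\<^bsub>free_group m\<^esub> v) \<le> occurrences j u + occurrences j v"
  using occurrences_reduce_le[of j "u @ v"] by (simp add: free_group_def)

lemma inv_free_group: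
  assumes "u \<in> carrier (free_group m)"
  shows "inv\<^bsub>free_group m\<^esub> u = reduce (rev (map inv_letter u))"
proof (rule group.inv_equality[OF group_free_group _ assms])
  show "reduce (rev (map inv_letter u)) \<in> carrier (free_group m)"
    using assms set_reduce[of "rev (map inv_letter u)"]
    by (fastforce simp: free_group_def reduced_reduce)
  show "reduce (rev (map inv_letter u)) \<otimes>\<^bsub>free_group m\<^esub> u = \<one>\<^bsub>free_group m\<^esub>"
    using assms by (simp add: free_group_def reduce_append reduce_reduced foldr_push_reduce
        reduce_inverse)
qed

lemma free_gen_in_carrier [simp]: "i < m \<Longrightarrow> free_gen i \<in> carrier (free_group m)"
  by (simp add: free_group_def free_gen_def reduced_def)

lemma inv_free_gen: "i < m \<Longrightarrow> inv\<^bsub>free_group m\<^esub> (free_gen i) = [(i, False)]"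
  by (subst inv_free_group) (simp_all, simp add: free_gen_def inv_letter_def reduce_def)

lemma occurrences_inverse_le:
  assumes "u \<in> carrier (free_group m)"
  shows "occurrences j (inv\<^bsub>free_group m\<^esub> u) \<le> occurrences j u"
  using occurrences_reduce_le[of j "rev (map inv_letter u)"]
  by (simp add: inv_free_group[OF assms] occurrences_rev_map_inv_letter)

text \<open>
  Substituting the images of the letters into \<open>w\<close> and then cancelling does not create new
  letters, and inverting a word preserves its letter counts, so only the counts in the images of
  the generators matter.
\<close>
lemma occurrences_hom_le:
  assumes f: "f \<in> hom (free_group m) (free_group m)"
    and w: "w \<in> carrier (free_group m)"
  shows "occurrences j (f w) \<le> (\<Sum>l<m. occurrences l w * occurrences j (f (free_gen l)))"
  using w
proof (induction w)
  case Nil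
  have "f [] = []"
    using hom_one[OF f group_free_group group_free_group] by (simp add: free_group_def)
  then show ?case by simp
next
  case (Cons x w)
  interpret group_hom "free_group m" "free_group m" f
    using f by (simp add: group_hom_def group_hom_axioms_def group_free_group)
  have w: "w \<in> carrier (free_group m)" and x: "[x] \<in> carrier (free_group m)"
    and red: "reduced (x # w)" and xm: "fst x < m"
    using Cons.prems by (auto simp: free_group_def reduced_Cons)
  have "x # w = [x] \<otimes>\<^bsub>free_group m\<^esub> w"
    using reduce_reduced[OF red] by (simp add: free_group_def)
  then have "occurrences j (f (x # w)) \<le> occurrences j (f [x]) + occurrences j (f w)"
    using occurrences_mult_le[of j m "f [x]" "f w"] x w by simp
  also have "occurrences j (f [x]) \<le> occurrences j (f (free_gen (fst x)))"
  proof (cases "snd x")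
    case True
    then have "[x] = free_gen (fst x)" by (simp add: free_gen_def prod_eq_iff)
    then show ?thesis by simp
  next
    case False
    then have "[x] = inv\<^bsub>free_group m\<^esub> (free_gen (fst x))"
      using xm by (simp add: inv_free_gen prod_eq_iff)
    then have "f [x] = inv\<^bsub>free_group m\<^esub> (f (free_gen (fst x)))"
      using xm by simp
    then show ?thesis
      using occurrences_inverse_le[of "f (free_gen (fst x))" m j] xm by simp
  qed
  also have "occurrences j (f w) \<le> (\<Sum>l<m. occurrences l w * occurrences j (f (free_gen l)))"
    using Cons.IH w by blast
  also have "occurrences j (f (free_gen (fst x)))
        + (\<Sum>l<m. occurrences l w * occurrences j (f (free_gen l)))
      = (\<Sum>l<m. occurrences l (x # w) * occurrences j (f (free_gen l)))"
    using xm by (simp add: occurrences_Cons algebra_simps sum.distrib if_distrib[of "\<lambda>t. _ * t"]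
        cong: if_cong)
  finally show ?case by simp
qed

section \<open>Matrices bounding an endomorphism\<close>

text \<open>
  The incidence matrix of a composition is only bounded by the product of the incidence matrices,
  so upper bounds for incidence matrices, rather than the matrices themselves, are what can be
  carried along a word or a power. Natural number entries keep the bounds in an ordered semiring;
  the passage to complex matrices is made only when spectral radii are taken.
\<close>
definition dominates :: "nat \<Rightarrow> nat mat \<Rightarrow> (letter list \<Rightarrow> letter list) \<Rightarrow> bool" where
  "dominates m N f \<longleftrightarrow> N \<in> carrier_mat m m \<and>
    (\<forall>i<m. \<forall>j<m. occurrences j (f (free_gen i)) \<le> N $$ (i, j))"

lemma dominates_comp:
  assumes f: "f \<in> hom (free_group m) (free_group m)" "dominates m N f"
    and g: "g \<in> hom (free_group m) (free_group m)" "dominates m P g"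
  shows "dominates m (P * N) (f \<circ> g)"
  unfolding dominates_def
proof (intro conjI allI impI)
  have NP: "N \<in> carrier_mat m m" "P \<in> carrier_mat m m"
    using f g by (auto simp: dominates_def)
  then show "P * N \<in> carrier_mat m m" by simp
  fix i j assume ij: "i < m" "j < m"
  have "g (free_gen i) \<in> carrier (free_group m)"
    using g(1) ij by (auto simp: hom_def)
  then have "occurrences j ((f \<circ> g) (free_gen i))
      \<le> (\<Sum>l<m. occurrences l (g (free_gen i)) * occurrences j (f (free_gen l)))"
    using occurrences_hom_le[OF f(1)] by simp
  also have "\<dots> \<le> (\<Sum>l<m. P $$ (i, l) * N $$ (l, j))"
    using f(2) g(2) ij by (intro sum_mono mult_mono) (auto simp: dominates_def)
  also have "\<dots> = (P * N) $$ (i, j)"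
    using NP ij by (simp add: scalar_prod_def atLeast0LessThan)
  finally show "occurrences j ((f \<circ> g) (free_gen i)) \<le> (P * N) $$ (i, j)" .
qed

lemma dominates_one: "(\<And>i. i < m \<Longrightarrow> f (free_gen i) = free_gen i) \<Longrightarrow> dominates m (1\<^sub>m m) f"
  by (auto simp: dominates_def free_gen_def occurrences_Cons)

lemma hom_funpow:
  assumes "f \<in> hom G G"
  shows "f ^^ n \<in> hom G G"
proof (induction n)
  case (Suc n)
  then show ?case using assms by (auto simp: hom_def Pi_iff)
qed (simp add: hom_def)

lemma dominates_funpow:
  assumes "f \<in> hom (free_group m) (free_group m)" "dominates m N f"
  shows "dominates m (N ^\<^sub>m n) (f ^^ n)"
proof (induction n)
  case 0
  have "N ^\<^sub>m 0 = 1\<^sub>m m" using assms(2) by (auto simp: dominates_def)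
  then show ?case using dominates_one[of m id] by (simp add: id_def)
next
  case (Suc n)
  then show ?case
    using dominates_comp[OF assms hom_funpow[OF assms(1)] Suc]
    by (simp only: funpow.simps pow_mat.simps)
qed

definition count_matrix :: "nat \<Rightarrow> (letter list \<Rightarrow> letter list) \<Rightarrow> nat mat" where
  "count_matrix m f = mat m m (\<lambda>(i, j). occurrences j (f (free_gen i)))"

lemma incidence_matrix_eq: "incidence_matrix m f = map_mat of_nat (count_matrix m f)"
  by (rule eq_matI) (auto simp: incidence_matrix_def count_matrix_def)

lemma count_matrix_carrier [simp]: "count_matrix m f \<in> carrier_mat m m"
  by (simp add: count_matrix_def)

lemma dominates_count_matrix: "dominates m (count_matrix m f) f"
  by (simp add: dominates_def count_matrix_def)

section \<open>Products of lists of matrices\<close>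

lemma foldr_mult_mat_carrier [simp]:
  "set Ms \<subseteq> carrier_mat n n \<Longrightarrow> foldr (*) Ms (1\<^sub>m n) \<in> carrier_mat n n"
  by (induction Ms) auto

lemma foldr_mult_mat_append:
  fixes Ms Ns :: "'a::semiring_1 mat list"
  assumes "set Ms \<subseteq> carrier_mat n n" "set Ns \<subseteq> carrier_mat n n"
  shows "foldr (*) (Ms @ Ns) (1\<^sub>m n) = foldr (*) Ms (1\<^sub>m n) * foldr (*) Ns (1\<^sub>m n)"
  using assms(1)
proof (induction Ms)
  case Nil
  then show ?case using left_mult_one_mat[OF foldr_mult_mat_carrier[OF assms(2)]] by simp
next
  case (Cons M Ms)
  then show ?case
    using assms(2) assoc_mult_mat[of M n n "foldr (*) Ms (1\<^sub>m n)" n "foldr (*) Ns (1\<^sub>m n)" n]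
    by (simp del: foldr_append)
qed

text \<open>
  Powers of one product are again products of matrices from the same set. This links the spectral
  radius of a single product to products of unbounded length.
\<close>
lemma foldr_mult_mat_replicate:
  fixes Ms :: "'a::semiring_1 mat list"
  assumes "set Ms \<subseteq> carrier_mat n n"
  shows "foldr (*) (concat (replicate k Ms)) (1\<^sub>m n) = foldr (*) Ms (1\<^sub>m n) ^\<^sub>m k"
proof (induction k)
  case 0
  have "dim_row (foldr (*) Ms (1\<^sub>m n)) = n"
    using foldr_mult_mat_carrier[OF assms] by blast
  then show ?case by simp
next
  case (Suc k)
  have "concat (replicate (Suc k) Ms) = concat (replicate k Ms) @ Ms"
    by (induction k) auto
  moreover have "set (concat (replicate k Ms)) \<subseteq> carrier_mat n n"
    using assms by (auto simp: set_replicate_conv_if)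
  ultimately show ?case
    using assms Suc.IH by (simp only: foldr_mult_mat_append pow_mat.simps)
qed

lemma foldr_mult_mat_of_nat:
  assumes "set Ns \<subseteq> carrier_mat n n"
  shows "foldr (*) (map (map_mat (of_nat :: nat \<Rightarrow> complex)) Ns) (1\<^sub>m n)
    = map_mat of_nat (foldr (*) Ns (1\<^sub>m n))"
proof -
  interpret h: semiring_hom "of_nat :: nat \<Rightarrow> complex" by unfold_locales auto
  show ?thesis
    using assms
    by (induction Ns) (auto simp: h.mat_hom_one h.mat_hom_mult[of _ n n _ n])
qed

section \<open>Powers and the spectral radius\<close>

lemma spectral_radius_nonneg:
  assumes "A \<in> carrier_mat n n" "n > 0"
  shows "0 \<le> spectral_radius A"
  using spectral_radius_mem_max(1)[OF assms] by auto

lemma norm_eigenvalue_le: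
  assumes "A \<in> carrier_mat n n" "n > 0" "eigenvector A v c"
  shows "norm c \<le> spectral_radius A"
proof -
  have "c \<in> spectrum A" using assms(3) by (auto simp: spectrum_def eigenvalue_def)
  then show ?thesis by (intro spectral_radius_mem_max(2)[OF assms(1,2)] imageI)
qed

lemma dominant_eigenvector:
  assumes "A \<in> carrier_mat n n" "n > 0"
  shows "\<exists>v c. eigenvector A v c \<and> norm c = spectral_radius A"
proof -
  obtain c where "c \<in> spectrum A" "norm c = spectral_radius A"
    using spectral_radius_mem_max(1)[OF assms] by (metis imageE)
  then show ?thesis by (auto simp: spectrum_def eigenvalue_def)
qed

lemma spectral_radius_power_le:
  assumes A: "A \<in> carrier_mat n n" and n: "n > 0"
  shows "spectral_radius A ^ k \<le> spectral_radius (A ^\<^sub>m k)"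
proof -
  obtain v c where v: "eigenvector A v c" and c: "norm c = spectral_radius A"
    using dominant_eigenvector[OF A n] by blast
  have "eigenvector (A ^\<^sub>m k) v (c ^ k)"
    using v eigenvector_pow[OF A v, of k] A by (simp add: eigenvector_def)
  then show ?thesis
    using norm_eigenvalue_le[OF pow_carrier_mat[OF A] n] c by (metis norm_power)
qed

lemma smult_mat_pow:
  fixes A :: "'a::comm_ring_1 mat"
  assumes A: "A \<in> carrier_mat n n"
  shows "(c \<cdot>\<^sub>m A) ^\<^sub>m k = c ^ k \<cdot>\<^sub>m A ^\<^sub>m k"
proof (induction k)
  case 0
  then show ?case using A by (auto intro!: eq_matI)
next
  case (Suc k)
  have "A ^\<^sub>m k * (c \<cdot>\<^sub>m A) = c \<cdot>\<^sub>m (A ^\<^sub>m k * A)"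
    by (rule mult_smult_distrib[OF pow_carrier_mat[OF A] A])
  moreover have "(c ^ k \<cdot>\<^sub>m A ^\<^sub>m k) * (c \<cdot>\<^sub>m A) = c ^ k \<cdot>\<^sub>m (A ^\<^sub>m k * (c \<cdot>\<^sub>m A))"
    using A by (intro mult_smult_assoc_mat[of _ n n _ n]) auto
  ultimately show ?case
    using Suc by (auto intro!: eq_matI)
qed

text \<open>
  After dividing \<open>A\<close> by \<open>t\<close> all eigenvalues lie strictly inside the unit disc, and by the Jordan
  normal form the powers of such a matrix are bounded.
\<close>
lemma power_entries_le:
  assumes A: "A \<in> carrier_mat n n" and n: "n > 0" and t: "spectral_radius A < t"
  shows "\<exists>C. \<forall>k. \<forall>i<n. \<forall>j<n. norm ((A ^\<^sub>m k) $$ (i, j)) \<le> C * t ^ k"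
proof -
  have t0: "t > 0" using spectral_radius_nonneg[OF A n] t by simp
  define B where "B = complex_of_real (1 / t) \<cdot>\<^sub>m A"
  have B: "B \<in> carrier_mat n n" using A by (simp add: B_def)
  obtain v c where v: "eigenvector B v c" and c: "norm c = spectral_radius B"
    using dominant_eigenvector[OF B n] by blast
  have vc: "v \<in> carrier_vec n" using v B by (simp add: eigenvector_def)
  have "A = complex_of_real t \<cdot>\<^sub>m B"
    using t0 A by (auto simp: B_def intro!: eq_matI)
  then have "A *\<^sub>v v = complex_of_real t \<cdot>\<^sub>v (B *\<^sub>v v)"
    using vc B by (auto intro!: eq_vecI)
  then have "eigenvector A v (complex_of_real t * c)"
    using v A B by (auto simp: eigenvector_def smult_smult_assoc)
  then have "t * norm c \<le> spectral_radius A"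
    using norm_eigenvalue_le[OF A n] t0 by (fastforce simp: norm_mult)
  then have "t * norm c < t * 1" using t by simp
  then have "spectral_radius B < 1" using t0 c by (simp only: mult_less_cancel_left_pos)
  then obtain C where C: "\<And>k. norm_bound (B ^\<^sub>m k) C"
    using spectral_radius_jnf_norm_bound_less_1_upper_triangular[OF B] by blast
  show ?thesis
  proof (intro exI allI impI)
    fix k i j assume ij: "i < n" "j < n"
    have "(B ^\<^sub>m k) $$ (i, j) = complex_of_real (1 / t) ^ k * (A ^\<^sub>m k) $$ (i, j)"
      using A ij by (simp add: B_def smult_mat_pow)
    then have "norm ((A ^\<^sub>m k) $$ (i, j)) = norm ((B ^\<^sub>m k) $$ (i, j)) * t ^ k"
      using t0 by (simp add: norm_mult norm_power norm_divide power_divide)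
    moreover have "norm ((B ^\<^sub>m k) $$ (i, j)) \<le> C"
      using C[of k] B ij by (simp add: norm_bound_def)
    ultimately show "norm ((A ^\<^sub>m k) $$ (i, j)) \<le> C * t ^ k"
      using t0 by (simp add: mult_right_mono)
  qed
qed

lemma max_spectral_radius_ge:
  assumes "finite \<M>" "length Ms = r" "set Ms \<subseteq> \<M>"
  shows "root r (spectral_radius (foldr (*) Ms (1\<^sub>m n))) \<le> max_spectral_radius n r \<M>"
proof -
  let ?W = "{Ms. length Ms = r \<and> set Ms \<subseteq> \<M>}"
  have "finite ?W"
    using finite_lists_length_eq[OF assms(1), of r] by (simp add: conj_commute)
  then have "finite ((\<lambda>Ms. root r (spectral_radius (foldr (*) Ms (1\<^sub>m n)))) ` ?W)" by simp
  moreover have "(\<lambda>Ms. root r (spectral_radius (foldr (*) Ms (1\<^sub>m n)))) ` ?W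
    = {root r (spectral_radius (foldr (*) Ms (1\<^sub>m n))) | Ms. length Ms = r \<and> set Ms \<subseteq> \<M>}"
    by blast
  ultimately show ?thesis
    unfolding max_spectral_radius_def using assms by (intro Max_ge) auto
qed

text \<open>
  Let \<open>M\<close> be the product and \<open>r\<close> its length. Repeating the word \<open>k\<close> times gives a product of
  length \<open>k r\<close> whose spectral radius is at least the \<open>k\<close>-th power of that of \<open>M\<close>, so the bound
  recurs along the multiples of \<open>r\<close>; this suffices because an upper limit is taken.
\<close>
lemma generalized_spectral_radius_ge:
  assumes fin: "finite \<M>" and sub: "\<M> \<subseteq> carrier_mat n n" and n: "n > 0"
    and Ms: "Ms \<noteq> []" "set Ms \<subseteq> \<M>"
  shows "ereal (root (length Ms) (spectral_radius (foldr (*) Ms (1\<^sub>m n))))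
    \<le> generalized_spectral_radius n \<M>"
proof -
  define r where "r = length Ms"
  define M where "M = foldr (*) Ms (1\<^sub>m n)"
  have r: "r > 0" using Ms by (simp add: r_def)
  have M: "M \<in> carrier_mat n n" using Ms sub by (auto simp: M_def)
  define X where "X = (\<lambda>s. ereal (max_spectral_radius n s \<M>))"
  have "ereal (root r (spectral_radius M)) \<le> (X \<circ> (\<lambda>k. Suc k * r)) k" for k
  proof -
    let ?Ms = "concat (replicate (Suc k) Ms)"
    have "root r (spectral_radius M) = root (Suc k * r) (spectral_radius M ^ Suc k)"
      using r spectral_radius_nonneg[OF M n]
      by (metis mult.commute real_root_mult_exp real_root_power_cancel zero_less_Suc)
    also have "\<dots> \<le> root (Suc k * r) (spectral_radius (M ^\<^sub>m Suc k))"
      using r spectral_radius_power_le[OF M n, of "Suc k"] by (intro real_root_le_mono) auto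
    also have "M ^\<^sub>m Suc k = foldr (*) ?Ms (1\<^sub>m n)"
      using foldr_mult_mat_replicate[of Ms n "Suc k"] Ms sub by (auto simp: M_def)
    also have "root (Suc k * r) (spectral_radius (foldr (*) ?Ms (1\<^sub>m n)))
        \<le> max_spectral_radius n (Suc k * r) \<M>"
      using Ms by (intro max_spectral_radius_ge[OF fin])
        (auto simp: length_concat sum_list_replicate r_def set_replicate_conv_if)
    finally show ?thesis by (simp add: X_def)
  qed
  then have "ereal (root r (spectral_radius M)) \<le> limsup (X \<circ> (\<lambda>k. Suc k * r))"
    by (intro le_Limsup always_eventually) auto
  also have "\<dots> \<le> limsup X"
    using r by (intro limsup_subseq_mono) (simp add: strict_mono_def)
  finally show ?thesis by (simp add: X_def generalized_spectral_radius_def r_def M_def)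
qed

section \<open>Exponential growth rates\<close>

text \<open>
  The lower bound \<open>1 \<le> u n\<close> makes \<open>\<rho> < 1\<close> impossible, since \<open>u\<close> would then tend to \<open>0\<close>. For the
  upper limit, a base \<open>t\<close> slightly above \<open>\<rho>\<close> costs only \<open>ln t - ln \<rho>\<close>, and the constant \<open>C\<close>
  contributes the vanishing term \<open>(ln C) / n\<close>.
\<close>
lemma limsup_log_le:
  fixes u :: "nat \<Rightarrow> real"
  assumes u: "\<And>n. 1 \<le> u n" and \<rho>: "0 \<le> \<rho>"
    and bound: "\<And>t. \<rho> < t \<Longrightarrow> \<exists>C. \<forall>n. u n \<le> C * t ^ n"
  shows "1 \<le> \<rho>" and "limsup (\<lambda>n. ereal (ln (u n) / real n)) \<le> ereal (ln \<rho>)"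
proof -
  show \<rho>1: "1 \<le> \<rho>"
  proof (rule ccontr)
    assume "\<not> 1 \<le> \<rho>"
    then obtain t where t: "\<rho> < t" "t < 1" using dense[of \<rho> 1] by auto
    obtain C where C: "\<And>n. u n \<le> C * t ^ n" using bound[OF t(1)] by blast
    have "(\<lambda>n. C * t ^ n) \<longlonglongrightarrow> C * 0"
      using t \<rho> by (intro tendsto_intros LIMSEQ_realpow_zero) auto
    moreover have "1 \<le> C * t ^ n" for n using u[of n] C[of n] by linarith
    ultimately have "1 \<le> C * 0"
      by (intro tendsto_lowerbound[of "\<lambda>n. C * t ^ n"]) auto
    then show False by simp
  qed
  show "limsup (\<lambda>n. ereal (ln (u n) / real n)) \<le> ereal (ln \<rho>)"
  proof (rule ereal_le_epsilon2)
    fix e :: real assume e: "0 < e"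
    define t where "t = \<rho> * exp e"
    have t: "\<rho> < t" "0 < t" using \<rho>1 e by (auto simp: t_def)
    obtain C where C: "\<And>n. u n \<le> C * t ^ n" using bound[OF t(1)] by blast
    have C0: "0 < C" using C[of 0] u[of 0] by simp
    have "ln (u n) / real n \<le> ln C / real n + ln t" if n: "n > 0" for n
    proof -
      have "ln (u n) \<le> ln (C * t ^ n)"
        using C[of n] u[of n] by (intro ln_mono) auto
      also have "\<dots> = ln C + real n * ln t"
        using C0 t by (simp add: ln_mult ln_realpow)
      finally have "ln (u n) / real n \<le> (ln C + real n * ln t) / real n"
        by (rule divide_right_mono) simp
      then show ?thesis using n by (simp add: field_simps)
    qed
    then have "limsup (\<lambda>n. ereal (ln (u n) / real n))
        \<le> limsup (\<lambda>n. ereal (ln C / real n + ln t))"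
      by (intro Limsup_mono eventually_sequentiallyI[of 1]) auto
    also have "\<dots> = ereal (0 + ln t)"
    proof (intro lim_imp_Limsup)
      have "(\<lambda>n. ln C / real n + ln t) \<longlonglongrightarrow> 0 + ln t"
        by (intro tendsto_intros lim_const_over_n)
      then show "(\<lambda>n. ereal (ln C / real n + ln t)) \<longlonglongrightarrow> ereal (0 + ln t)" by simp
    qed simp
    also have "\<dots> = ereal (ln \<rho>) + ereal e"
      using \<rho>1 by (simp add: t_def ln_mult)
    finally show "limsup (\<lambda>n. ereal (ln (u n) / real n)) \<le> ereal (ln \<rho>) + ereal e" .
  qed
qed

section \<open>Entropy and the spectral radius\<close>

lemma auto_funpow_free_gen_nonempty:
  assumes b: "b \<in> auto (free_group m)" and i: "i < m"
  shows "(b ^^ n) (free_gen i) \<in> carrier (free_group m)" "(b ^^ n) (free_gen i) \<noteq> []"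
proof -
  have inj: "inj_on b (carrier (free_group m))" and hom: "b \<in> hom (free_group m) (free_group m)"
    using b by (auto simp: auto_def Bij_def bij_betw_def)
  have one: "b [] = []" "[] \<in> carrier (free_group m)"
    using hom_one[OF hom group_free_group group_free_group] by (auto simp: free_group_def)
  have "(b ^^ n) (free_gen i) \<in> carrier (free_group m) \<and> (b ^^ n) (free_gen i) \<noteq> []"
  proof (induction n)
    case 0
    then show ?case using i by simp (simp add: free_gen_def)
  next
    case (Suc n)
    then show ?case
      using hom_in_carrier[OF hom] inj_onD[OF inj, of "(b ^^ n) (free_gen i)" "[]"] one by auto
  qed
  then show "(b ^^ n) (free_gen i) \<in> carrier (free_group m)" "(b ^^ n) (free_gen i) \<noteq> []"
    by auto
qed

text \<open>
  The length of \<open>b\<^sup>n x\<^sub>i\<close> is at most the sum of row \<open>i\<close> of the \<open>n\<close>-th power of \<open>N\<close>, so it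
  satisfies the growth hypothesis of \<open>limsup_log_le\<close>; the lower bound \<open>1\<close> holds because the
  injective map \<open>b\<^sup>n\<close> sends no generator to the empty word.
\<close>
lemma entropy_le_ln_spectral_radius:
  assumes m: "m > 0" and b: "b \<in> auto (free_group m)" and N: "dominates m N b"
  defines "\<rho> \<equiv> spectral_radius (map_mat of_nat N)"
  shows "1 \<le> \<rho>" and "entropy m b \<le> ereal (ln \<rho>)"
proof -
  let ?M = "map_mat of_nat N :: complex mat"
  interpret h: semiring_hom "of_nat :: nat \<Rightarrow> complex" by unfold_locales auto
  have hom: "b \<in> hom (free_group m) (free_group m)" using b by (simp add: auto_def)
  have Nc: "N \<in> carrier_mat m m" using N by (simp add: dominates_def)
  then have M: "?M \<in> carrier_mat m m" by simp
  have \<rho>0: "0 \<le> \<rho>" unfolding \<rho>_def by (rule spectral_radius_nonneg[OF M m])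
  have bound: "\<exists>C. \<forall>n. real (length ((b ^^ n) (free_gen i))) \<le> C * t ^ n"
    if t: "\<rho> < t" and i: "i < m" for t i
  proof -
    obtain C where C: "\<And>k i j. i < m \<Longrightarrow> j < m \<Longrightarrow> norm ((?M ^\<^sub>m k) $$ (i, j)) \<le> C * t ^ k"
      using power_entries_le[OF M m t[unfolded \<rho>_def]] by blast
    have "real (length ((b ^^ n) (free_gen i))) \<le> (real m * C) * t ^ n" for n
    proof -
      have "length ((b ^^ n) (free_gen i)) = (\<Sum>j<m. occurrences j ((b ^^ n) (free_gen i)))"
        using auto_funpow_free_gen_nonempty(1)[OF b i]
        by (intro length_eq_sum_occurrences) (auto simp: free_group_def)
      also have "\<dots> \<le> (\<Sum>j<m. (N ^\<^sub>m n) $$ (i, j))"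
        using dominates_funpow[OF hom N, of n] i by (intro sum_mono) (simp add: dominates_def)
      finally have "real (length ((b ^^ n) (free_gen i))) \<le> (\<Sum>j<m. real ((N ^\<^sub>m n) $$ (i, j)))"
        by (metis of_nat_le_iff of_nat_sum)
      also have "\<dots> \<le> (\<Sum>j<m. C * t ^ n)"
      proof (rule sum_mono)
        fix j assume "j \<in> {..<m}"
        then have j: "j < m" by simp
        have "?M ^\<^sub>m n = map_mat of_nat (N ^\<^sub>m n)" by (rule h.mat_hom_pow[OF Nc, symmetric])
        then have "(?M ^\<^sub>m n) $$ (i, j) = of_nat ((N ^\<^sub>m n) $$ (i, j))"
          using Nc i j by simp
        then show "real ((N ^\<^sub>m n) $$ (i, j)) \<le> C * t ^ n"
          using C[OF i j, of n] by simp
      qed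
      finally show ?thesis by simp
    qed
    then show ?thesis by blast
  qed
  have ge1: "1 \<le> real (length ((b ^^ n) (free_gen i)))" if "i < m" for n i
    using auto_funpow_free_gen_nonempty(2)[OF b that, of n]
    by (metis One_nat_def Suc_leI length_greater_0_conv of_nat_1 of_nat_le_iff)
  show "1 \<le> \<rho>" by (rule limsup_log_le(1)[OF ge1[OF m] \<rho>0 bound[OF _ m]])
  have "limsup (\<lambda>n. ereal (ln (real (length ((b ^^ n) (free_gen i)))) / real n)) \<le> ereal (ln \<rho>)"
    if "i < m" for i
    by (rule limsup_log_le(2)[OF ge1[OF that] \<rho>0 bound[OF _ that]])
  then show "entropy m b \<le> ereal (ln \<rho>)"
    unfolding entropy_def using m by (subst Max_le_iff) auto
qed

section \<open>Words in the generators\<close>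

lemma foldr_mult_in_carrier:
  assumes "group G" "set w \<subseteq> carrier G"
  shows "foldr (\<otimes>\<^bsub>G\<^esub>) w \<one>\<^bsub>G\<^esub> \<in> carrier G"
proof -
  interpret group G by fact
  show ?thesis using assms(2) by (induction w) auto
qed

lemma semigroup_generated_word:
  assumes G: "group G" and S: "S \<subseteq> carrier G" and b: "b \<in> semigroup_generated G S"
  shows "\<exists>w. w \<noteq> [] \<and> set w \<subseteq> S \<and> foldr (\<otimes>\<^bsub>G\<^esub>) w \<one>\<^bsub>G\<^esub> = b"
proof -
  interpret group G by fact
  have append: "foldr (\<otimes>\<^bsub>G\<^esub>) (u @ v) \<one>\<^bsub>G\<^esub>
      = foldr (\<otimes>\<^bsub>G\<^esub>) u \<one>\<^bsub>G\<^esub> \<otimes>\<^bsub>G\<^esub> foldr (\<otimes>\<^bsub>G\<^esub>) v \<one>\<^bsub>G\<^esub>"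
    if u: "set u \<subseteq> carrier G" and v: "set v \<subseteq> carrier G" for u v
    using u
  proof (induction u)
    case (Cons x u)
    then show ?case
      using foldr_mult_in_carrier[OF G v] foldr_mult_in_carrier[OF G, of u]
      by (simp add: m_assoc del: foldr_append)
  qed (use foldr_mult_in_carrier[OF G v] in simp)
  show ?thesis
    using b
  proof induction
    case (generator b)
    then show ?case using S by (intro exI[of _ "[b]"]) auto
  next
    case (product a b)
    then obtain u v where "u \<noteq> []" "set u \<subseteq> S" "foldr (\<otimes>\<^bsub>G\<^esub>) u \<one>\<^bsub>G\<^esub> = a"
      "set v \<subseteq> S" "foldr (\<otimes>\<^bsub>G\<^esub>) v \<one>\<^bsub>G\<^esub> = b" by blast
    then show ?case using append[of u v] S by (intro exI[of _ "u @ v"]) auto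
  qed
qed

lemma semigroup_length_word:
  assumes "group G" "S \<subseteq> carrier G" "b \<in> semigroup_generated G S"
  shows "\<exists>w. w \<noteq> [] \<and> length w = semigroup_length G S b \<and> set w \<subseteq> S
    \<and> foldr (\<otimes>\<^bsub>G\<^esub>) w \<one>\<^bsub>G\<^esub> = b"
proof -
  let ?P = "\<lambda>r. 1 \<le> r \<and> (\<exists>w. length w = r \<and> set w \<subseteq> S \<and> foldr (\<otimes>\<^bsub>G\<^esub>) w \<one>\<^bsub>G\<^esub> = b)"
  obtain w where "w \<noteq> []" "set w \<subseteq> S" "foldr (\<otimes>\<^bsub>G\<^esub>) w \<one>\<^bsub>G\<^esub> = b"
    using semigroup_generated_word[OF assms] by blast
  then have "?P (length w)" by (auto simp: Suc_le_eq)
  then have "?P (semigroup_length G S b)"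
    unfolding semigroup_length_def by (rule LeastI)
  then obtain w where "1 \<le> length w" "length w = semigroup_length G S b" "set w \<subseteq> S"
    "foldr (\<otimes>\<^bsub>G\<^esub>) w \<one>\<^bsub>G\<^esub> = b" by auto
  then show ?thesis by (intro exI[of _ w]) auto
qed

text \<open>
  In \<open>AutoGroup\<close> the last factor of a word is applied first, whereas the matrix of the map applied
  first stands leftmost in a dominating product: hence the reversal.
\<close>
lemma dominates_foldr_mult:
  assumes "set w \<subseteq> carrier (AutoGroup (free_group m))"
  shows "dominates m (foldr (*) (map (count_matrix m) (rev w)) (1\<^sub>m m))
    (foldr (\<otimes>\<^bsub>AutoGroup (free_group m)\<^esub>) w \<one>\<^bsub>AutoGroup (free_group m)\<^esub>)"
  using assms
proof (induction w)
  case Nil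
  show ?case by (auto intro!: dominates_one simp: AutoGroup_def BijGroup_def)
next
  case (Cons b w)
  let ?G = "AutoGroup (free_group m)"
  define c where "c = foldr (\<otimes>\<^bsub>?G\<^esub>) w \<one>\<^bsub>?G\<^esub>"
  have c: "c \<in> auto (free_group m)"
    using foldr_mult_in_carrier[OF group.AutoGroup[OF group_free_group], of w m] Cons.prems
    by (simp add: c_def AutoGroup_def)
  have b: "b \<in> auto (free_group m)" using Cons.prems by (simp add: AutoGroup_def)
  have "b \<otimes>\<^bsub>?G\<^esub> c = compose (carrier (free_group m)) b c"
    using b c by (simp add: AutoGroup_def BijGroup_def auto_def)
  then have "\<And>i. i < m \<Longrightarrow> (b \<otimes>\<^bsub>?G\<^esub> c) (free_gen i) = (b \<circ> c) (free_gen i)"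
    by (simp add: compose_eq)
  moreover have "dominates m
      (foldr (*) (map (count_matrix m) (rev w)) (1\<^sub>m m) * count_matrix m b) (b \<circ> c)"
    using Cons b c by (intro dominates_comp dominates_count_matrix) (auto simp: auto_def c_def)
  moreover have "foldr (*) (map (count_matrix m) (rev (b # w))) (1\<^sub>m m)
      = foldr (*) (map (count_matrix m) (rev w)) (1\<^sub>m m) * count_matrix m b"
    using foldr_mult_mat_append[of "map (count_matrix m) (rev w)" m "[count_matrix m b]"]
      right_mult_one_mat[OF count_matrix_carrier[of m b]]
    by (simp add: image_subset_iff del: foldr_append)
  ultimately show ?case
    by (simp add: dominates_def c_def)
qed

lemma ereal_ln_ge:
  assumes "1 \<le> x" "ereal x \<le> y"
  shows "ereal (ln x) \<le> ereal_ln y"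
  using assms by (cases y) (auto simp: ereal_ln_def)

theorem proposition5p1:
  fixes m k :: nat
    and a :: "nat \<Rightarrow> letter list \<Rightarrow> letter list"
    and \<A> :: "(letter list \<Rightarrow> letter list) set"
  assumes "1 \<le> m" and "1 \<le> k"
    and "\<And>i. i \<in> {1..k} \<Longrightarrow> a i \<in> carrier (AutoGroup (free_group m))"
    and "\<A> = semigroup_generated (AutoGroup (free_group m)) (a ` {1..k})"
  shows "Efficiency m \<A> (a ` {1..k})
    \<le> ereal_ln (generalized_spectral_radius m ((\<lambda>i. incidence_matrix m (a i)) ` {1..k}))"
  unfolding Efficiency_def
proof (rule SUP_least)
  let ?G = "AutoGroup (free_group m)"
  let ?S = "a ` {1..k}"
  let ?\<M> = "(\<lambda>i. incidence_matrix m (a i)) ` {1..k}"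
  fix b assume "b \<in> \<A>"
  then have b: "b \<in> semigroup_generated ?G ?S" using assms(4) by simp
  have G: "group ?G" by (rule group.AutoGroup[OF group_free_group])
  have S: "?S \<subseteq> carrier ?G" using assms(3) by auto
  have m: "m > 0" using assms(1) by simp
  obtain w where w: "w \<noteq> []" "length w = semigroup_length ?G ?S b" "set w \<subseteq> ?S"
    "foldr (\<otimes>\<^bsub>?G\<^esub>) w \<one>\<^bsub>?G\<^esub> = b"
    using semigroup_length_word[OF G S b] by blast
  define r where "r = length w"
  have r: "r > 0" using w(1) by (simp add: r_def)
  define N where "N = foldr (*) (map (count_matrix m) (rev w)) (1\<^sub>m m)"
  define Ms where "Ms = map (incidence_matrix m) (rev w)"
  define \<rho> where "\<rho> = spectral_radius (map_mat of_nat N)"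
  have "b \<in> auto (free_group m)"
    using foldr_mult_in_carrier[OF G, of w] w S by (auto simp: AutoGroup_def)
  moreover have "dominates m N b"
    using dominates_foldr_mult[of w m] w S by (auto simp: N_def)
  ultimately have \<rho>: "1 \<le> \<rho>" and entropy: "entropy m b \<le> ereal (ln \<rho>)"
    using entropy_le_ln_spectral_radius[OF m] by (auto simp: \<rho>_def)
  have "Ms = map (map_mat of_nat) (map (count_matrix m) (rev w))"
    by (simp add: Ms_def incidence_matrix_eq)
  then have "foldr (*) Ms (1\<^sub>m m) = map_mat of_nat N"
    unfolding N_def by (simp only:) (rule foldr_mult_mat_of_nat, auto)
  moreover have "?\<M> \<subseteq> carrier_mat m m" by (auto simp: incidence_matrix_def)
  moreover have "Ms \<noteq> []" "length Ms = r" "set Ms \<subseteq> ?\<M>"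
    using w by (auto simp: Ms_def r_def)
  ultimately have "ereal (root r \<rho>) \<le> generalized_spectral_radius m ?\<M>"
    using generalized_spectral_radius_ge[of ?\<M> m Ms] m
    by (simp add: \<rho>_def)
  then have "ereal (ln (root r \<rho>)) \<le> ereal_ln (generalized_spectral_radius m ?\<M>)"
    using \<rho> r by (intro ereal_ln_ge) auto
  moreover have "efficiency m ?S b \<le> ereal (ln \<rho>) / ereal (real r)"
    unfolding efficiency_def w(2)[symmetric] r_def[symmetric]
    using entropy r by (intro ereal_divide_right_mono) auto
  moreover have "ereal (ln \<rho>) / ereal (real r) = ereal (ln (root r \<rho>))"
    using \<rho> r by (simp add: ln_root)
  ultimately show "efficiency m ?S b
      \<le> ereal_ln (generalized_spectral_radius m ?\<M>)" by simp
qed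

end
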